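(* Let $N=\{n!:n\geqslant 1\}=\{1,2,6,24,\ldots\}$. For all integers $a,b\geqslant 6$, we have $p_N(a)\,p_N(b)>p_N(a+b)$.
   Context: $p_N(n)$ denotes the number of partitions of $n$ all of whose parts are factorials $k!$ with $k\geqslant1$. *)

theory Defs
  imports Complex_Main "HOL-Library.Multiset"
begin

definition partitions_into :: "nat set \<Rightarrow> nat \<Rightarrow> nat multiset set" where
  "partitions_into S n = {M. (\<forall>x\<in>#M. 0 < x \<and> x \<in> S) \<and> sum_mset M = n}"

definition num_partitions_into :: "nat set \<Rightarrow> nat \<Rightarrow> nat" where
  "num_partitions_into S n = card (partitions_into S n)"

(* k starts at 1; since 0! = 1! this does not affect the set. *)
definition factorials :: "nat set" where
  "factorials = {fact k | k. k \<ge> 1}"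

(* So the cardinality above is never the default value 0 of an infinite set. *)
lemma finite_partitions_into: "finite (partitions_into S n)"
proof (rule finite_subset)
  show "partitions_into S n \<subseteq> mset ` {xs. set xs \<subseteq> {..n} \<and> length xs \<le> n}"
  proof
    fix M assume M: "M \<in> partitions_into S n"
    obtain xs where xs: "M = mset xs" by (metis ex_mset)
    from M have pos: "\<forall>x\<in>set xs. 0 < x" and sum: "sum_list xs = n"
      by (auto simp: partitions_into_def xs sum_mset_sum_list)
    have "length xs \<le> sum_list xs"
      using pos by (induction xs) (auto simp: Suc_le_eq)
    moreover have "set xs \<subseteq> {..n}"
      using sum member_le_sum_list by fastforce
    ultimately show "M \<in> mset ` {xs. set xs \<subseteq> {..n} \<and> length xs \<le> n}"
      using xs sum by blast
  qed
  show "finite (mset ` {xs. set xs \<subseteq> {..n} \<and> length xs \<le> n})"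
    by (intro finite_imageI finite_lists_length_le) simp
qed

end

theory Submission
  imports Defs
begin

text \<open>Let \<open>p k n\<close> count the partitions of \<open>n\<close> into parts \<open>1!, \<dots>, k!\<close>. For \<open>6 \<le> a \<le> b\<close> one shows
  \<open>p k a * p k b \<ge> p k (a + b) + p k a\<close> by induction on \<open>k \<ge> 3\<close>, simultaneously with the stronger
  bound \<open>p k a * p k b \<ge> p k (a + b) + 6 * p k a\<close> for \<open>2 * b \<ge> (k + 1)!\<close>. In the step to a new part
  \<open>m = (k + 1)!\<close>, if \<open>b < m \<le> a + b\<close> the new partitions of \<open>a + b\<close> number
  \<open>p k (a + b - m) \<le> p k a\<close>, which the stronger bound absorbs as \<open>2 * b \<ge> m\<close>. If \<open>b \<ge> m\<close>, one
  removes a part \<open>m\<close> from \<open>b\<close> and from \<open>a + b\<close>; when \<open>b - m < 6\<close> the claim is not available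
  for \<open>b - m\<close>, and the growth bound \<open>p (k + 1) (a + 5) \<le> 6 * p (k + 1) a\<close> replaces it.\<close>

section \<open>Recurrence in the largest part\<close>

lemma num_partitions_into_insert:
  assumes "m > 0" and "m \<notin> S"
  shows "num_partitions_into (insert m S) n =
           num_partitions_into S n
           + (if m \<le> n then num_partitions_into (insert m S) (n - m) else 0)"
proof -
  let ?T = "insert m S"
  let ?A = "{M \<in> partitions_into ?T n. m \<in># M}"
  have split: "partitions_into ?T n = partitions_into S n \<union> ?A"
    using assms by (auto simp: partitions_into_def)
  have disj: "partitions_into S n \<inter> ?A = {}"
    using assms by (auto simp: partitions_into_def)
  have fin: "finite ?A"
    using finite_partitions_into[of ?T n] by simp
  \<comment> \<open>Deleting one copy of \<open>m\<close> is a bijection; further copies may remain,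
    so \<open>?T\<close> appears again on the right.\<close>
  have A: "?A = (if m \<le> n then add_mset m ` partitions_into ?T (n - m) else {})"
  proof (cases "m \<le> n")
    case True
    have "M \<in> add_mset m ` partitions_into ?T (n - m)" if M: "M \<in> ?A" for M
    proof -
      obtain K where K: "M = add_mset m K"
        using M multi_member_split[of m M] by blast
      then have "K \<in> partitions_into ?T (n - m)"
        using M by (auto simp: partitions_into_def)
      then show ?thesis using K by blast
    qed
    then show ?thesis
      using True assms by (auto simp: partitions_into_def)
  next
    case False
    have "m \<le> n" if "M \<in> ?A" for M
      using that by (auto simp: partitions_into_def dest!: multi_member_split)
    then show ?thesis using False by auto
  qed
  have "card ?A = (if m \<le> n then num_partitions_into ?T (n - m) else 0)"
    unfolding A num_partitions_into_def by (auto simp: card_image inj_on_def)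
  moreover have "card (partitions_into ?T n) = card (partitions_into S n) + card ?A"
    using card_Un_disjoint[OF finite_partitions_into fin disj] split by metis
  ultimately show ?thesis
    by (simp only: num_partitions_into_def)
qed

definition fact_parts :: "nat \<Rightarrow> nat \<Rightarrow> nat" where
  "fact_parts k n = num_partitions_into (fact ` {1..k}) n"

lemma fact_parts_0: "fact_parts 0 n = (if n = 0 then 1 else 0)"
proof -
  have "partitions_into {} n = (if n = 0 then {{#}} else {})"
    by (auto simp: partitions_into_def)
  then show ?thesis
    by (simp add: fact_parts_def num_partitions_into_def)
qed

lemma fact_parts_Suc:
  "fact_parts (Suc k) n = fact_parts k n
     + (if fact (Suc k) \<le> n then fact_parts (Suc k) (n - fact (Suc k)) else 0)"
proof -
  have eq: "fact ` {1..Suc k} = insert (fact (Suc k)) (fact ` {1..k} :: nat set)"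
    by (simp add: atLeastAtMostSuc_conv)
  have "(fact (Suc k) :: nat) \<notin> fact ` {1..k}"
  proof
    assume "(fact (Suc k) :: nat) \<in> fact ` {1..k}"
    then obtain j where "1 \<le> j" "j \<le> k" "(fact (Suc k) :: nat) = fact j" by auto
    moreover have "(fact j :: nat) < fact (Suc k)"
      using calculation by (intro fact_less_mono_nat) auto
    ultimately show False by simp
  qed
  then show ?thesis
    unfolding fact_parts_def eq by (intro num_partitions_into_insert) (auto simp del: fact_Suc)
qed

lemma num_partitions_into_factorials:
  assumes "n < fact (Suc k)"
  shows "num_partitions_into factorials n = fact_parts k n"
proof -
  have "x \<in> fact ` {1..k}" if x: "x \<in> factorials" "x \<le> n" for x
  proof -
    obtain j where j: "j \<ge> 1" "x = fact j"
      using x(1) unfolding factorials_def by blast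
    have "\<not> Suc k \<le> j"
      using fact_mono_nat[of "Suc k" j] j x(2) assms by linarith
    then show ?thesis using j by auto
  qed
  moreover have "x \<le> sum_mset M" if "x \<in># M" for x and M :: "nat multiset"
    using that by (auto dest!: multi_member_split)
  moreover have "fact ` {1..k} \<subseteq> factorials"
    by (auto simp: factorials_def)
  ultimately have "partitions_into factorials n = partitions_into (fact ` {1..k}) n"
    unfolding partitions_into_def by blast
  then show ?thesis by (simp add: fact_parts_def num_partitions_into_def)
qed

section \<open>Counts with parts 1, 2 and 6\<close>

lemma fact_parts_1: "fact_parts (Suc 0) n = 1"
  by (induction n) (subst fact_parts_Suc; simp add: fact_parts_0)+

lemma fact_parts_2: "fact_parts (Suc (Suc 0)) n = n div 2 + 1"
proof (induction n rule: less_induct)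
  case (less n)
  then show ?case
    by (subst fact_parts_Suc) (auto simp: fact_parts_1)
qed

text \<open>The number of partitions of \<open>2 * h\<close>, or of \<open>2 * h + 1\<close>, into
  parts 1, 2 and 6: \<open>h + 1\<close> of them avoid 6, and removing a 6 lowers \<open>h\<close>
  by 3.\<close>

fun half_parts :: "nat \<Rightarrow> nat" where
  "half_parts h = (if h < 3 then h + 1 else half_parts (h - 3) + h + 1)"

declare half_parts.simps [simp del]

lemma half_parts_add3: "half_parts (h + 3) = half_parts h + h + 4"
  by (subst half_parts.simps) simp

lemma fact_parts_3: "fact_parts 3 n = half_parts (n div 2)"
proof (induction n rule: less_induct)
  case (less n)
  have f3: "(fact (Suc (Suc (Suc 0))) :: nat) = 6" by simp
  have "fact_parts (Suc (Suc (Suc 0))) n = half_parts (n div 2)"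
  proof (cases "n < 6")
    case True
    then have "half_parts (n div 2) = n div 2 + 1"
      by (subst half_parts.simps) (use True in auto)
    then show ?thesis using True
      by (subst fact_parts_Suc) (simp only: f3, simp add: fact_parts_2)
  next
    case False
    have "half_parts (n div 2) = half_parts ((n - 6) div 2) + n div 2 + 1"
    proof -
      have "n div 2 = (n - 6) div 2 + 3" using False by linarith
      then show ?thesis using half_parts_add3[of "(n - 6) div 2"] by simp
    qed
    then show ?thesis using less[of "n - 6"] False
      by (subst fact_parts_Suc) (simp only: f3, simp add: fact_parts_2 numeral_3_eq_3)
  qed
  then show ?case by (simp add: numeral_3_eq_3)
qed

section \<open>Monotonicity and positivity\<close>

lemma fact_parts_Suc_mono: "fact_parts (Suc k) n \<le> fact_parts (Suc k) (Suc n)"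
proof (induction k arbitrary: n)
  case 0
  then show ?case by (simp add: fact_parts_1)
next
  case (Suc k)
  note outer = Suc
  show ?case
  proof (induction n rule: less_induct)
    case (less n)
    let ?m = "fact (Suc (Suc k)) :: nat"
    show ?case
    proof (cases "?m \<le> n")
      case True
      then have "n - ?m < n" "Suc n - ?m = Suc (n - ?m)"
        using fact_gt_zero[of "Suc (Suc k)", where 'a = nat] by linarith+
      then show ?thesis
        using True outer[of n] less[of "n - ?m"]
          fact_parts_Suc[of "Suc k" n] fact_parts_Suc[of "Suc k" "Suc n"]
        by (simp del: fact_Suc)
    next
      case False
      then show ?thesis
        using outer[of n] fact_parts_Suc[of "Suc k" n] fact_parts_Suc[of "Suc k" "Suc n"]
        by (simp del: fact_Suc)
    qed
  qed
qed

text \<open>The hypothesis \<open>1 \<le> k\<close> provides the part 1; \<open>fact_parts 0\<close>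
  drops from 1 at 0 to 0 at 1.\<close>

lemma fact_parts_mono:
  assumes "1 \<le> k" and "m \<le> n"
  shows "fact_parts k m \<le> fact_parts k n"
proof -
  obtain j where "k = Suc j" using assms(1) by (cases k) auto
  then show ?thesis
    using lift_Suc_mono_le[of "fact_parts k" m n] fact_parts_Suc_mono assms(2) by simp
qed

lemma fact_parts_mono_left:
  assumes "j \<le> k"
  shows "fact_parts j n \<le> fact_parts k n"
proof (rule lift_Suc_mono_le[of "\<lambda>k. fact_parts k n"])
  show "fact_parts i n \<le> fact_parts (Suc i) n" for i
    by (subst fact_parts_Suc) (rule le_add1)
qed (fact assms)

lemma fact_parts_pos:
  assumes "1 \<le> k"
  shows "1 \<le> fact_parts k n"
  using fact_parts_mono_left[of "Suc 0" k n] assms by (simp add: fact_parts_1)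

section \<open>Submultiplicativity for \<open>k = 3\<close>\<close>

lemma half_parts_mono:
  assumes "g \<le> h"
  shows "half_parts g \<le> half_parts h"
  using fact_parts_mono[of 3 "2 * g" "2 * h"] assms by (simp add: fact_parts_3)

lemma half_parts_ge: "h + 1 \<le> half_parts h"
  by (subst half_parts.simps) simp

lemma half_parts_values:
  "half_parts 3 = 5" "half_parts 4 = 7" "half_parts 5 = 9" "half_parts 6 = 12"
  "half_parts 7 = 15" "half_parts 8 = 18" "half_parts 9 = 22" "half_parts 10 = 26"
  "half_parts 11 = 30" "half_parts 12 = 35" "half_parts 13 = 40" "half_parts 14 = 45"
  by (simp_all add: half_parts.simps)

text \<open>The offsets 4 to 9 are \<open>h + 1\<close> for \<open>h\<close> from 3 to 8. The
  factors are \<open>half_parts h - 1\<close> for the first three and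
  \<open>half_parts h - 6\<close> for the last three, as \<open>half_parts_mult\<close>
  requires.\<close>

lemma half_parts_shift:
  assumes "3 \<le> g"
  shows "half_parts (g + 4) \<le> 4 * half_parts g
       \<and> half_parts (g + 5) \<le> 6 * half_parts g
       \<and> half_parts (g + 6) \<le> 8 * half_parts g
       \<and> half_parts (g + 7) \<le> 6 * half_parts g
       \<and> half_parts (g + 8) \<le> 9 * half_parts g
       \<and> half_parts (g + 9) \<le> 12 * half_parts g"
  using assms
proof (induction g rule: less_induct)
  case (less g)
  show ?case
  proof (cases "g < 6")
    case True
    then have "g = 3 \<or> g = 4 \<or> g = 5" using less.prems by linarith
    then show ?thesis by (elim disjE) (simp_all add: half_parts_values ac_simps)
  next
    case False
    define i where "i = g - 3"
    then have i: "g = i + 3" "3 \<le> i" using False by linarith+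
    have shift: "half_parts (g + c) = half_parts (i + c) + (i + c) + 4" for c
      using half_parts_add3[of "i + c"] i by (simp add: algebra_simps)
    have "half_parts g = half_parts i + i + 4"
      using half_parts_add3 i(1) by simp
    moreover have "i < g" using i(1) by simp
    note less.IH[OF this i(2)]
    ultimately show ?thesis
      using shift[of 4] shift[of 5] shift[of 6] shift[of 7] shift[of 8] shift[of 9] i(2)
      by (elim conjE, intro conjI; linarith)
  qed
qed

text \<open>Raising \<open>h\<close> by 3 adds \<open>g + h + 5\<close> on the left and at least
  \<open>(g + 1) * (h + 4)\<close> on the right, so any margin \<open>c\<close> survives.\<close>

lemma half_parts_mult_step:
  assumes "half_parts (g + h + 1) + c * half_parts g \<le> half_parts g * half_parts h" and "1 \<le> g"
  shows "half_parts (g + (h + 3) + 1) + c * half_parts g \<le> half_parts g * half_parts (h + 3)"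
proof -
  have "half_parts (g + (h + 3) + 1) = half_parts (g + h + 1) + (g + h + 1) + 4"
    using half_parts_add3[of "g + h + 1"] by (simp add: algebra_simps)
  moreover have "(g + 1) * (h + 4) \<le> half_parts g * (h + 4)"
    using half_parts_ge by (intro mult_le_mono1)
  moreover have "g + h + 5 \<le> (g + 1) * (h + 4)"
  proof -
    obtain j where "g = Suc j" using assms(2) by (cases g) auto
    then show ?thesis by (simp add: add_mult_distrib2)
  qed
  ultimately have "half_parts (g + (h + 3) + 1) + c * half_parts g
      \<le> half_parts g * half_parts h + half_parts g * (h + 4)"
    using assms(1) by linarith
  also have "\<dots> = half_parts g * half_parts (h + 3)"
    by (simp add: half_parts_add3 algebra_simps)
  finally show ?thesis .
qed

text \<open>The \<open>+ 1\<close> absorbs the carry when odd \<open>a\<close> and \<open>b\<close>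
  are halved; \<open>6 \<le> h\<close> reflects \<open>12 \<le> b\<close>, that is
  \<open>fact 4 \<le> 2 * b\<close>.\<close>

lemma half_parts_mult:
  assumes "3 \<le> g" and "3 \<le> h"
  shows "half_parts (g + h + 1) + half_parts g \<le> half_parts g * half_parts h
       \<and> (6 \<le> h \<longrightarrow> half_parts (g + h + 1) + 6 * half_parts g \<le> half_parts g * half_parts h)"
  using assms(2)
proof (induction h rule: less_induct)
  case (less h)
  consider "h = 3 \<or> h = 4 \<or> h = 5" | "h = 6 \<or> h = 7 \<or> h = 8" | "9 \<le> h"
    using less.prems by linarith
  then show ?case
  proof cases
    case 1
    then show ?thesis
      using half_parts_shift[OF assms(1)] by (elim disjE) (simp_all add: half_parts_values ac_simps)
  next
    case 2
    then show ?thesis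
      using half_parts_shift[OF assms(1)] by (elim disjE) (simp_all add: half_parts_values ac_simps)
  next
    case 3
    define i where "i = h - 3"
    then have i: "h = i + 3" "6 \<le> i" using 3 by linarith+
    then show ?thesis
      using less.IH[of i] half_parts_mult_step[of g i 6] assms(1) by simp
  qed
qed

lemma fact_parts_3_mult:
  assumes "6 \<le> a"
  shows "6 \<le> b \<Longrightarrow> fact_parts 3 (a + b) + fact_parts 3 a \<le> fact_parts 3 a * fact_parts 3 b"
    and "12 \<le> b \<Longrightarrow> fact_parts 3 (a + b) + 6 * fact_parts 3 a \<le> fact_parts 3 a * fact_parts 3 b"
proof -
  have "half_parts ((a + b) div 2) \<le> half_parts (a div 2 + b div 2 + 1)"
    by (intro half_parts_mono) linarith
  moreover have "3 \<le> a div 2" "6 \<le> b \<Longrightarrow> 3 \<le> b div 2" "12 \<le> b \<Longrightarrow> 6 \<le> b div 2"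
    using assms by linarith+
  ultimately show "6 \<le> b \<Longrightarrow> fact_parts 3 (a + b) + fact_parts 3 a \<le> fact_parts 3 a * fact_parts 3 b"
    and "12 \<le> b \<Longrightarrow> fact_parts 3 (a + b) + 6 * fact_parts 3 a \<le> fact_parts 3 a * fact_parts 3 b"
    using half_parts_mult[of "a div 2" "b div 2"] assms by (auto simp: fact_parts_3)
qed

section \<open>Growth bound and induction on \<open>k\<close>\<close>

lemma fact_parts_4_le:
  assumes "3 \<le> k"
  shows "fact_parts k 4 \<le> 3"
  using assms
proof (induction k rule: dec_induct)
  case base
  then show ?case by (simp add: fact_parts_3 half_parts.simps)
next
  case (step k)
  have "(fact 4 :: nat) \<le> fact (Suc k)"
    using step by (intro fact_mono_nat) simp
  then have "\<not> fact (Suc k) \<le> (4 :: nat)"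
    by (simp del: fact_Suc add: fact_numeral)
  then show ?case using step by (simp add: fact_parts_Suc[of k] del: fact_Suc)
qed

text \<open>Passing from \<open>k\<close> to \<open>Suc k\<close> costs at most 3, and only for \<open>n\<close> just below \<open>fact (Suc k)\<close>; the
  second bound holds that amount in reserve for exactly those \<open>n\<close>.\<close>

lemma fact_parts_add5:
  assumes "3 \<le> k"
  shows "fact_parts k (n + 5) \<le> 6 * fact_parts k n
       \<and> (fact (Suc k) \<le> n + 5 \<longrightarrow> fact_parts k (n + 5) + 3 \<le> 6 * fact_parts k n)"
  using assms
proof (induction k arbitrary: n rule: dec_induct)
  case base
  have "half_parts ((n + 5) div 2) \<le> half_parts (n div 2 + 3)"
    by (intro half_parts_mono) linarith
  then show ?case
    using half_parts_ge[of "n div 2"]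
    by (auto simp: fact_parts_3 half_parts_add3 fact_numeral)
next
  case (step k)
  let ?m = "fact (Suc k) :: nat"
  have m: "24 \<le> ?m"
    using fact_mono_nat[of 4 "Suc k"] step by (simp del: fact_Suc add: fact_numeral)
  \<comment> \<open>In the first two cases below \<open>n + 5 < 2 * ?m\<close>, so the reserve for
    \<open>Suc k\<close> is not yet demanded; in the third, the reserve for \<open>k\<close>
    supplies it.\<close>
  have M: "2 * ?m \<le> fact (Suc (Suc k))"
    by (simp add: algebra_simps)
  note rec = fact_parts_Suc[of k]
  \<comment> \<open>If \<open>n < ?m \<le> n + 5\<close>, removing \<open>?m\<close> from
    \<open>n + 5\<close> leaves at most 4, and 4 is only 2+2, 2+1+1 or 1+1+1+1: hence the reserve of
    3.\<close>
  have P4: "fact_parts (Suc k) r \<le> 3" if "r \<le> 4" for r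
    using fact_parts_4_le[of "Suc k"] fact_parts_mono[of "Suc k" r 4] that step by linarith
  show ?case
  proof (induction n rule: less_induct)
    case (less n)
    consider "n + 5 < ?m" | "n < ?m" "?m \<le> n + 5" | "?m \<le> n" by linarith
    then show ?case
    proof cases
      case 1
      then show ?thesis using step.IH[of n] rec[of n] rec[of "n + 5"] M by simp
    next
      case 2
      have "fact_parts (Suc k) (n + 5 - ?m) \<le> 3"
        using 2 by (intro P4) linarith
      then show ?thesis
        using 2 step.IH[of n] rec[of n] rec[of "n + 5"] M m
        by (simp del: fact_Suc)
    next
      case 3
      then have "n - ?m < n" "n + 5 - ?m = n - ?m + 5" using m by linarith+
      then show ?thesis
        using 3 step.IH[of n] less[of "n - ?m"] rec[of n] rec[of "n + 5"] M
        by (simp del: fact_Suc)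
    qed
  qed
qed

text \<open>Here \<open>S\<close> counts partitions into smaller parts, and \<open>P\<close> those that may also use the part
  \<open>m\<close>. The factor 6 for \<open>m \<le> 2 * b\<close> is a reserve: it pays for the partitions of \<open>a + b\<close>
  using \<open>m\<close> when \<open>a\<close> and \<open>b\<close> are themselves smaller than \<open>m\<close>.\<close>

lemma submultiplicative_add_part:
  fixes P S :: "nat \<Rightarrow> nat"
  assumes rec: "\<And>n. P n = S n + (if m \<le> n then P (n - m) else 0)"
    and m: "12 \<le> m"
    and S_mono: "\<And>i j. i \<le> j \<Longrightarrow> S i \<le> S j"
    and S_ge: "\<And>b. m \<le> 2 * b \<Longrightarrow> 6 \<le> S b"
    and P_pos: "\<And>n. 1 \<le> P n"
    and P_add: "\<And>n r. r \<le> 5 \<Longrightarrow> P (n + r) \<le> 6 * P n"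
    and S1: "\<And>a b. 6 \<le> a \<Longrightarrow> a \<le> b \<Longrightarrow> S (a + b) + S a \<le> S a * S b"
    and S6: "\<And>a b. 6 \<le> a \<Longrightarrow> a \<le> b \<Longrightarrow> m \<le> 2 * b \<Longrightarrow> S (a + b) + 6 * S a \<le> S a * S b"
    and a: "6 \<le> a" and ab: "a \<le> b"
  shows "P (a + b) + P a \<le> P a * P b"
    and "m + 6 \<le> b \<Longrightarrow> P (a + b) + 6 * P a \<le> P a * P b"
proof -
  \<comment> \<open>The excess \<open>e\<close> of \<open>P a\<close> over \<open>S a\<close>
    contributes \<open>e * S b\<close>, at least \<open>6 * e\<close>, so the reserve survives
    replacing \<open>S a\<close> by \<open>P a\<close>.\<close>
  have PS: "S (a + b) + 6 * P a \<le> P a * S b" if "6 \<le> a" "a \<le> b" "m \<le> 2 * b" for a b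
  proof -
    obtain e where e: "P a = S a + e" using rec by blast
    have "6 * e \<le> e * S b" using S_ge[OF that(3)] by simp
    then show ?thesis using S6[OF that] unfolding e distrib_left distrib_right by linarith
  qed
  have large: "P (a + b) + 6 * P a \<le> P a * P b"
    if "6 \<le> a" "a \<le> b" "m \<le> b" "P (a + (b - m)) \<le> P a * P (b - m)" for a b
  proof -
    have "P (a + b) = S (a + b) + P (a + (b - m))" "P b = S b + P (b - m)"
      using rec[of "a + b"] rec[of b] that by simp_all
    then show ?thesis using PS[of a b] that by (simp add: algebra_simps)
  qed
  have main: "P (a + b) + P a \<le> P a * P b" if "6 \<le> a" "a \<le> b" for a b
    using that
  proof (induction "a + b" arbitrary: a b rule: less_induct)
    case less
    consider "a + b < m" | "b < m" "m \<le> a + b" | "m \<le> b" "b < m + 6" | "m + 6 \<le> b"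
      by linarith
    then show ?case
    proof cases
      case 1
      then show ?thesis using rec[of a] rec[of b] rec[of "a + b"] S1[OF less.prems] by simp
    next
      case 2
      have "S (a + b - m) \<le> S a" using 2 by (intro S_mono) linarith
      \<comment> \<open>Here \<open>a + b - m < a \<le> b < m\<close>, so the part \<open>m\<close>
        is used at most once.\<close>
      moreover have "P (a + b) = S (a + b) + S (a + b - m)" "P a = S a" "P b = S b"
        using 2 less.prems rec[of "a + b"] rec[of "a + b - m"] rec[of a] rec[of b] m by auto
      moreover have "S (a + b) + 6 * S a \<le> S a * S b"
        using 2 less.prems by (intro S6) auto
      ultimately show ?thesis by simp
    next
      case 3
      have "P (a + b) = S (a + b) + P (a + (b - m))" "P b = S b + P (b - m)"
        using rec[of "a + b"] rec[of b] 3 by simp_all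
      moreover have "P (a + (b - m)) \<le> 6 * P a"
        using 3 by (intro P_add) linarith
      moreover have "P a \<le> P a * P (b - m)"
        using P_pos[of "b - m"] by simp
      moreover have "S (a + b) + 6 * P a \<le> P a * S b"
        using 3 less.prems by (intro PS) auto
      ultimately show ?thesis by (simp only: distrib_left)
    next
      case 4
      \<comment> \<open>Now \<open>b - m\<close> may be smaller than \<open>a\<close>, so the
        induction hypothesis is needed in both orders.\<close>
      have "P (a + (b - m)) \<le> P a * P (b - m)"
      proof -
        have "6 \<le> b - m" "a + (b - m) < a + b" "b - m + a < a + b"
          using 4 m by linarith+
        then show ?thesis
          using less.hyps[of a "b - m"] less.hyps[of "b - m" a] less.prems(1)
          by (cases "a \<le> b - m") (simp_all add: add.commute mult.commute)
      qed
      then show ?thesis using large[OF less.prems] 4 by simp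
    qed
  qed
  show "P (a + b) + P a \<le> P a * P b" using main a ab .
  assume b: "m + 6 \<le> b"
  have "P (a + (b - m)) \<le> P a * P (b - m)"
  proof -
    have "6 \<le> b - m" using b by linarith
    then show ?thesis
      using main[of a "b - m"] main[of "b - m" a] a
      by (cases "a \<le> b - m") (simp_all add: add.commute mult.commute)
  qed
  then show "P (a + b) + 6 * P a \<le> P a * P b" using large a ab b by simp
qed

lemma fact_parts_mult:
  assumes "3 \<le> k" and "6 \<le> a" and "a \<le> b"
  shows "fact_parts k (a + b) + fact_parts k a \<le> fact_parts k a * fact_parts k b
       \<and> (fact (Suc k) \<le> 2 * b \<longrightarrow>
            fact_parts k (a + b) + 6 * fact_parts k a \<le> fact_parts k a * fact_parts k b)"
  using assms
proof (induction k arbitrary: a b rule: dec_induct)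
  case base
  then show ?case using fact_parts_3_mult[of a b] by (simp add: fact_numeral)
next
  case (step k)
  let ?m = "fact (Suc k) :: nat"
  have m: "24 \<le> ?m"
    using fact_mono_nat[of 4 "Suc k"] step by (simp del: fact_Suc add: fact_numeral)
  \<comment> \<open>With \<open>?m \<ge> 24\<close>, the factor 5 lets
    \<open>fact (Suc (Suc k)) \<le> 2 * b\<close> force \<open>b \<ge> ?m + 6\<close>.\<close>
  have "5 * ?m \<le> Suc (Suc k) * ?m"
    using step by (intro mult_le_mono1) simp
  then have M: "5 * ?m \<le> fact (Suc (Suc k))"
    by (simp only: fact_Suc[of "Suc k"] of_nat_id)
  have ge: "6 \<le> fact_parts k b" if "?m \<le> 2 * b" for b
  proof -
    have "6 \<le> half_parts (b div 2)"
      using half_parts_ge[of "b div 2"] m that by linarith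
    then show ?thesis
      using fact_parts_mono_left[of 3 k b] step by (simp add: fact_parts_3)
  qed
  have add: "fact_parts (Suc k) (n + r) \<le> 6 * fact_parts (Suc k) n" if "r \<le> 5" for n r
    using fact_parts_add5[of "Suc k" n] fact_parts_mono[of "Suc k" "n + r" "n + 5"] step that
    by (simp del: fact_Suc)
  have m12: "12 \<le> ?m" using m by simp
  have mono: "fact_parts k i \<le> fact_parts k j" if "i \<le> j" for i j
    using fact_parts_mono that step by simp
  have pos: "1 \<le> fact_parts (Suc k) n" for n
    by (rule fact_parts_pos) simp
  have mult1: "fact_parts k (c + d) + fact_parts k c \<le> fact_parts k c * fact_parts k d"
    if "6 \<le> c" "c \<le> d" for c d
    using step.IH[OF that] by blast
  have mult6: "fact_parts k (c + d) + 6 * fact_parts k c \<le> fact_parts k c * fact_parts k d"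
    if "6 \<le> c" "c \<le> d" "?m \<le> 2 * d" for c d
    using step.IH[OF that(1,2)] that(3) by blast
  note mult = submultiplicative_add_part[where P = "fact_parts (Suc k)" and S = "fact_parts k"
      and m = ?m, OF fact_parts_Suc m12 mono ge pos add mult1 mult6 step.prems]
  have "?m + 6 \<le> b" if "fact (Suc (Suc k)) \<le> 2 * b"
    using that M m by linarith
  with mult show ?case by blast
qed

theorem theorem6p3:
  fixes a b :: nat
  assumes "a \<ge> 6" and "b \<ge> 6"
  shows "num_partitions_into factorials a * num_partitions_into factorials b
           > num_partitions_into factorials (a + b)"
proof -
  \<comment> \<open>One \<open>k\<close> must serve \<open>a\<close>, \<open>b\<close> and
    \<open>a + b\<close>; this one does because \<open>n \<le> fact n\<close>.\<close>
  define k where "k = a + b"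
  have "a + b < fact (Suc k)"
    using fact_ge_self[of "Suc k"] by (simp add: k_def del: fact_Suc)
  then have eq: "num_partitions_into factorials n = fact_parts k n" if "n \<le> a + b" for n
    using that by (intro num_partitions_into_factorials) simp
  have k: "3 \<le> k" using assms by (simp add: k_def)
  \<comment> \<open>The spare summand \<open>fact_parts k c\<close>, being at least 1, makes the
    inequality strict.\<close>
  have less: "fact_parts k (c + d) < fact_parts k c * fact_parts k d" if "6 \<le> c" "c \<le> d" for c d
    using fact_parts_mult[OF k that] fact_parts_pos[of k c] k by linarith
  have "fact_parts k (a + b) < fact_parts k a * fact_parts k b"
    using less[of a b] less[of b a] assms by (cases "a \<le> b") (simp_all add: ac_simps)
  then show ?thesis by (simp add: eq)
qed

end
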